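(* Consider a sequence $\{F_n\}_n$ in $\Delta_+$ and a sequence $\{k_n\}_n$ of positive integers with $k_1<k_2<\cdots$. The following conditions are equivalent. (1) There exists $F\in\Delta_+$ such that $F_n^{\vee k_n}\xrightarrow{w}F$ as $n\to\infty$. (2) There exists $G\in\Delta_+$ such that $F_n^{\cup_\vee k_n}\xrightarrow{w}G$ as $n\to\infty$. If either (1) or (2) holds, then $\mathcal{X}(G)=F$ and $\mathcal{X}^{-1}(F)=G$.
   Context: $\Delta_+$ is the set of all (cumulative) distribution functions $F$ of probability measures on $\mathbb{R}$ with $F(x)=0$ for all $x<0$ (an atom at $0$ is allowed). $\xrightarrow{w}$ denotes weak convergence, i.e. pointwise convergence at every continuity point of the limit distribution function. (Classical) max-convolution: $F\vee G=FG$ (pointwise product), and $F^{\vee k}=F^k$ is the $k$-fold max-convolution. Boolean max-convolution: for $x,y\in[0,1]$, $x\cup_\vee y$ is defined by $(x\cup_\vee y)^{-1}-1=(x^{-1}-1)+(y^{-1}-1)$ if $x,y>0$, and $x\cup_\vee y=0$ if $x=0$ or $y=0$. For $F,G\in\Delta_+$, $(F\cup_\vee G)(x)=F(x)\cup_\vee G(x)$, and $F^{\cup_\vee k}=\dfrac{F}{k-(k-1)F}$ is the $k$-fold Boolean max-convolution of $F$ with itself. The bijection $\mathcal{X}:[0,1]\to[0,1]$ is $\mathcal{X}(u)=\exp(1-u^{-1})$ for $u\in(0,1]$, $\mathcal{X}(0)=0$, with inverse $\mathcal{X}^{-1}(u)=\frac{1}{1-\log u}$ for $u\in(0,1]$,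 $\mathcal{X}^{-1}(0)=0$. They act on $F\in\Delta_+$ pointwise: $\mathcal{X}(F)(x)=\mathcal{X}(F(x))$ and $\mathcal{X}^{-1}(F)(x)=\mathcal{X}^{-1}(F(x))$, giving elements of $\Delta_+$. *)

theory Defs
  imports "HOL-Probability.Weak_Convergence"
begin

definition Delta_plus :: "(real \<Rightarrow> real) set" where
  "Delta_plus = {F. (\<exists>M. real_distribution M \<and> F = cdf M) \<and> (\<forall>x<0. F x = 0)}"

definition max_conv :: "(real \<Rightarrow> real) \<Rightarrow> (real \<Rightarrow> real) \<Rightarrow> real \<Rightarrow> real" where
  "max_conv F G = (\<lambda>x. F x * G x)"

(* For x, y > 0 this is the equation 1/z - 1 = (1/x - 1) + (1/y - 1) solved for z;
   see bool_max_op_eq below. Only arguments in [0,1] are of interest. *)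
definition bool_max_op :: "real \<Rightarrow> real \<Rightarrow> real" where
  "bool_max_op x y =
     (if x > 0 \<and> y > 0 then inverse (1 + (inverse x - 1) + (inverse y - 1)) else 0)"

definition bool_max_conv :: "(real \<Rightarrow> real) \<Rightarrow> (real \<Rightarrow> real) \<Rightarrow> real \<Rightarrow> real" where
  "bool_max_conv F G = (\<lambda>x. bool_max_op (F x) (G x))"

(* k copies of F combined with the binary operation c. Meaningful for k > 0 only:
   by truncated subtraction, k = 0 gives F. *)
definition conv_power :: "('a \<Rightarrow> 'a \<Rightarrow> 'a) \<Rightarrow> nat \<Rightarrow> 'a \<Rightarrow> 'a" where
  "conv_power c k F = (c F ^^ (k - 1)) F"

abbreviation max_conv_power :: "nat \<Rightarrow> (real \<Rightarrow> real) \<Rightarrow> real \<Rightarrow> real" where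
  "max_conv_power \<equiv> conv_power max_conv"

abbreviation bool_max_conv_power :: "nat \<Rightarrow> (real \<Rightarrow> real) \<Rightarrow> real \<Rightarrow> real" where
  "bool_max_conv_power \<equiv> conv_power bool_max_conv"

(* The bijection of [0,1] and its inverse; values outside [0,1] are irrelevant.
   The case u = 0 is explicit because 1 / 0 = 0 and ln 0 = 0 in HOL. *)
definition Xmap :: "real \<Rightarrow> real" where
  "Xmap u = (if u = 0 then 0 else exp (1 - inverse u))"

definition Xmap_inv :: "real \<Rightarrow> real" where
  "Xmap_inv u = (if u = 0 then 0 else 1 / (1 - ln u))"

lemma Delta_plus_bounds:
  assumes "F \<in> Delta_plus"
  shows "0 \<le> F x" "F x \<le> 1"
proof -
  obtain M where M: "real_distribution M" "F = cdf M"
    using assms by (auto simp: Delta_plus_def)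
  interpret real_distribution M by fact
  show "0 \<le> F x" "F x \<le> 1"
    using M by (auto simp: cdf_def)
qed

lemma bool_max_op_eq:
  assumes "0 < x" "x \<le> 1" "0 < y" "y \<le> 1"
  shows "0 < bool_max_op x y" "bool_max_op x y \<le> 1"
    and "inverse (bool_max_op x y) - 1 = (inverse x - 1) + (inverse y - 1)"
proof -
  have "1 \<le> inverse x" "1 \<le> inverse y"
    using assms by (auto intro: one_le_inverse)
  then show "0 < bool_max_op x y" "bool_max_op x y \<le> 1"
    "inverse (bool_max_op x y) - 1 = (inverse x - 1) + (inverse y - 1)"
    using assms by (auto simp: bool_max_op_def intro: inverse_le_1_iff[THEN iffD2])
qed

lemma max_conv_power_eq:
  assumes "k > 0"
  shows "max_conv_power k F = (\<lambda>x. F x ^ k)"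
proof -
  have "(max_conv F ^^ m) F = (\<lambda>x. F x ^ Suc m)" for m
    by (induction m) (auto simp: max_conv_def)
  from this[of "k - 1"] show ?thesis
    using assms by (simp add: conv_power_def)
qed

lemma bool_max_conv_power_eq:
  assumes "k > 0" "F \<in> Delta_plus"
  shows "bool_max_conv_power k F = (\<lambda>x. F x / (real k - (real k - 1) * F x))"
proof -
  have "(bool_max_conv F ^^ m) F x = F x / (real (Suc m) - real m * F x)" for m x
  proof (induction m)
    case 0
    show ?case by simp
  next
    case (Suc m)
    show ?case
    proof (cases "F x = 0")
      case True
      then show ?thesis by (simp add: bool_max_conv_def bool_max_op_def)
    next
      case False
      then have x: "0 < F x" "F x \<le> 1"
        using Delta_plus_bounds[OF assms(2), of x] by auto
      then have le: "real j * F x \<le> real j" for j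
        by (simp add: mult_left_le)
      have pos: "0 < real (Suc j) - real j * F x" for j
        using le[of j] by simp
      let ?D = "real (Suc m) - real m * F x"
      have "(bool_max_conv F ^^ Suc m) F x = bool_max_op (F x) (F x / ?D)"
        by (simp add: bool_max_conv_def[of F "(bool_max_conv F ^^ m) F"] Suc)
      also have "\<dots> = inverse (inverse (F x) + ?D / F x - 1)"
        using x pos[of m] by (simp add: bool_max_op_def)
      also have "inverse (F x) + ?D / F x - 1 = (real (Suc (Suc m)) - real (Suc m) * F x) / F x"
        using x by (simp add: field_simps)
      finally show ?thesis by simp
    qed
  qed
  from this[of "k - 1"] show ?thesis
    using assms by (auto simp: conv_power_def of_nat_diff)
qed

lemma Xmap_inverse:
  assumes "u \<in> {0..1}"
  shows "Xmap u \<in> {0..1}" "Xmap_inv u \<in> {0..1}"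
    and "Xmap_inv (Xmap u) = u" "Xmap (Xmap_inv u) = u"
proof -
  have "u = 0 \<or> (0 < u \<and> 1 \<le> inverse u \<and> ln u \<le> 0)"
    using assms by (auto intro: one_le_inverse)
  then show "Xmap u \<in> {0..1}" "Xmap_inv u \<in> {0..1}"
    "Xmap_inv (Xmap u) = u" "Xmap (Xmap_inv u) = u"
    by (auto simp: Xmap_def Xmap_inv_def divide_simps)
qed

lemma Xmap_bij: "bij_betw Xmap {0..1} {0..1}"
  by (rule bij_betw_byWitness[where f' = Xmap_inv]) (use Xmap_inverse in blast)+

end

theory Submission
  imports Defs
begin

text \<open>
  Fix \<open>u \<in> [0,1]\<close> and \<open>k \<ge> 1\<close>. Writing every number of \<open>[0,1]\<close> as \<open>1 / (1 + v)\<close> with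
  \<open>v \<in> [0,\<infinity>]\<close>, the Boolean power of \<open>u\<close> has \<open>v = k (1/u - 1)\<close>, while \<open>\<X>\<^sup>-\<^sup>1(u\<^sup>k)\<close> has
  \<open>v = - k ln u\<close>. When \<open>u\<close> is near \<open>1\<close>, \<open>1/u - 1\<close> and \<open>- ln u\<close> nearly agree; when it
  is not, both values of \<open>v\<close> are at least of order \<open>k\<close>, so that both numbers are near \<open>0\<close>. Quantitatively,
  the two numbers differ by at most \<open>1/k\<close>, uniformly in \<open>u\<close> (lemma \<open>Xmap_inv_power_approx\<close>).

  As the integers \<open>k\<^sub>n\<close> tend to infinity, the Boolean powers and the \<open>\<X>\<^sup>-\<^sup>1\<close>-images of the classical
  powers thus have the same pointwise limits. Moreover \<open>\<X>\<close> is an increasing homeomorphism of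
  \<open>[0,1]\<close>, so composing with \<open>\<X>\<close> or \<open>\<X>\<^sup>-\<^sup>1\<close> preserves pointwise limits, continuity points and
  membership in \<open>\<Delta>\<^sub>+\<close>. Hence \<open>F\<close> is a weak limit of the classical powers if and only if
  \<open>\<X>\<^sup>-\<^sup>1(F)\<close> is a weak limit of the Boolean powers. The relation between \<open>F\<close> and \<open>G\<close>
  then follows from uniqueness of weak limits.
\<close>

section \<open>The homeomorphism of the unit interval\<close>

lemma Xmap_le_self:
  assumes "u \<in> {0..1}"
  shows "Xmap u \<le> u"
proof (cases "u = 0")
  case False
  then have "0 < u" using assms by auto
  have "inverse u \<le> exp (inverse u - 1)"
    using exp_ge_add_one_self[of "inverse u - 1"] by simp
  then have "inverse (exp (inverse u - 1)) \<le> u"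
    using le_imp_inverse_le[of "inverse u" "exp (inverse u - 1)"] \<open>0 < u\<close> by simp
  moreover have "inverse (exp (inverse u - 1)) = Xmap u"
    using \<open>0 < u\<close> by (simp add: Xmap_def flip: exp_minus)
  ultimately show ?thesis by simp
qed (simp add: Xmap_def)

text \<open>Away from \<open>0\<close> this is continuity of elementary functions; at \<open>0\<close>, \<open>\<X>\<close> is squeezed
  between \<open>0\<close> and the identity.\<close>

lemma continuous_on_Xmap: "continuous_on {0..1} Xmap"
  unfolding continuous_on_def
proof
  fix u :: real assume u: "u \<in> {0..1}"
  show "(Xmap \<longlongrightarrow> Xmap u) (at u within {0..1})"
  proof (cases "u = 0")
    case True
    have ev: "\<forall>\<^sub>F v in at 0 within {0..1}. v \<in> {0..1::real}"
      by (simp add: eventually_at_filter)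
    have "(Xmap \<longlongrightarrow> 0) (at 0 within {0..1})"
    proof (rule tendsto_sandwich[OF _ _ tendsto_const tendsto_ident_at])
      show "\<forall>\<^sub>F v in at 0 within {0..1}. 0 \<le> Xmap v"
        using ev by eventually_elim (simp add: Xmap_def)
      show "\<forall>\<^sub>F v in at 0 within {0..1}. Xmap v \<le> v"
        using ev by eventually_elim (rule Xmap_le_self)
    qed
    then show ?thesis by (simp add: True Xmap_def)
  next
    case False
    have "((\<lambda>v. exp (1 - inverse v)) \<longlongrightarrow> exp (1 - inverse u)) (at u within {0..1})"
      using False by (intro tendsto_intros)
    moreover have "\<forall>\<^sub>F v in at u within {0..1}. v \<noteq> 0"
      using tendsto_imp_eventually_ne[OF tendsto_ident_at False] .
    then have "\<forall>\<^sub>F v in at u within {0..1}. exp (1 - inverse v) = Xmap v"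
      by eventually_elim (simp add: Xmap_def)
    ultimately have "(Xmap \<longlongrightarrow> exp (1 - inverse u)) (at u within {0..1})"
      by (rule Lim_transform_eventually)
    then show ?thesis using False by (simp add: Xmap_def)
  qed
qed

lemma continuous_on_Xmap_inv: "continuous_on {0..1} Xmap_inv"
proof -
  have "continuous_on (Xmap ` {0..1}) Xmap_inv"
    using continuous_on_Xmap by (rule continuous_on_inv) (auto intro: Xmap_inverse(3))
  then show ?thesis
    using Xmap_bij by (simp add: bij_betw_def)
qed

lemma mono_on_Xmap: "mono_on {0..1} Xmap"
proof (rule mono_onI)
  fix u v :: real assume "u \<in> {0..1}" "v \<in> {0..1}" "u \<le> v"
  then show "Xmap u \<le> Xmap v"
    by (cases "u = 0") (auto simp: Xmap_def)
qed

lemma mono_on_Xmap_inv: "mono_on {0..1} Xmap_inv"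
proof (rule mono_onI)
  fix u v :: real assume uv: "u \<in> {0..1}" "v \<in> {0..1}" "u \<le> v"
  show "Xmap_inv u \<le> Xmap_inv v"
  proof (cases "u = 0")
    case True
    then show ?thesis using Xmap_inverse(2)[OF uv(2)] by (simp add: Xmap_inv_def)
  next
    case False
    then have ln: "ln u \<le> ln v" "ln v \<le> 0" using uv by auto
    then have "1 / (1 - ln u) \<le> 1 / (1 - ln v)"
      by (intro divide_left_mono mult_pos_pos) linarith+
    then show ?thesis using False uv by (simp add: Xmap_inv_def)
  qed
qed

lemma tendsto_Xmap_inv_iff:
  assumes f: "\<And>x. f x \<in> {0..1}" and l: "l \<in> {0..1}"
  shows "((\<lambda>x. Xmap_inv (f x)) \<longlongrightarrow> Xmap_inv l) N \<longleftrightarrow> (f \<longlongrightarrow> l) N"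
proof
  assume "((\<lambda>x. Xmap_inv (f x)) \<longlongrightarrow> Xmap_inv l) N"
  then have "((\<lambda>x. Xmap (Xmap_inv (f x))) \<longlongrightarrow> Xmap (Xmap_inv l)) N"
    by (rule continuous_on_tendsto_compose[OF continuous_on_Xmap])
       (use f l Xmap_inverse(2) in auto)
  then show "(f \<longlongrightarrow> l) N"
    using Xmap_inverse(4)[OF f] Xmap_inverse(4)[OF l] by simp
next
  assume "(f \<longlongrightarrow> l) N"
  then show "((\<lambda>x. Xmap_inv (f x)) \<longlongrightarrow> Xmap_inv l) N"
    by (rule continuous_on_tendsto_compose[OF continuous_on_Xmap_inv]) (use f l in auto)
qed

section \<open>Comparison of the classical and the Boolean powers\<close>

text \<open>For \<open>0 < u < 1\<close> and \<open>t = 1 - u\<close>, the bounds \<open>t \<le> - ln u \<le> 1/u - 1\<close> place \<open>\<X>\<^sup>-\<^sup>1(u\<^sup>k)\<close> between the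
  Boolean power \<open>u / (u + k t)\<close> and \<open>1 / (1 + k t)\<close>. These two differ by
  \<open>k t\<^sup>2 / ((1 + k t) (u + k t))\<close>, which is at most \<open>k t\<^sup>2 / (k t)\<^sup>2 = 1/k\<close>.\<close>

lemma Xmap_inv_power_approx:
  fixes u :: real
  assumes u: "u \<in> {0..1}" and k: "k > 0"
  shows "\<bar>Xmap_inv (u ^ k) - u / (real k - (real k - 1) * u)\<bar> \<le> 1 / real k"
proof -
  consider "u = 0" | "u = 1" | "0 < u" "u < 1" using u by fastforce
  then show ?thesis
  proof cases
    case 3
    define c where "c = real k * (1 - u)"
    have c: "0 < c" using k 3 by (simp add: c_def)
    have bool: "u / (real k - (real k - 1) * u) = u / (u + c)"
      by (simp add: c_def algebra_simps)
    have cls: "Xmap_inv (u ^ k) = 1 / (1 - real k * ln u)"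
      using 3 by (simp add: Xmap_inv_def ln_realpow)
    have "c \<le> - (real k * ln u)"
      using mult_left_mono[OF ln_le_minus_one[of u], of "real k"] 3
      by (simp add: c_def algebra_simps)
    then have upper: "1 / (1 - real k * ln u) \<le> 1 / (1 + c)"
      using c by (intro divide_left_mono) auto
    have "- ln u \<le> inverse u - 1"
      using ln_le_minus_one[of "inverse u"] 3 by (simp add: ln_inverse)
    then have "- (real k * ln u) \<le> real k * (inverse u - 1)"
      using mult_left_mono[of "- ln u" "inverse u - 1" "real k"] by simp
    also have "\<dots> = c / u"
      using 3 by (simp add: c_def field_simps)
    finally have "1 / (1 + c / u) \<le> 1 / (1 - real k * ln u)"
      using \<open>c \<le> - (real k * ln u)\<close> c 3 by (intro divide_left_mono) (auto intro!: mult_pos_pos add_pos_pos)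
    moreover have "1 / (1 + c / u) = u / (u + c)"
      using 3 c by (simp add: field_simps)
    ultimately have lower: "u / (u + c) \<le> 1 / (1 - real k * ln u)" by simp
    have "1 / (1 + c) - u / (u + c) = c * (1 - u) / ((1 + c) * (u + c))"
      using 3 c by (simp add: divide_simps) (simp add: algebra_simps)
    also have "\<dots> \<le> c * (1 - u) / (c * c)"
      using 3 c by (intro divide_left_mono mult_mono) auto
    also have "\<dots> = 1 / real k"
      using 3 k by (simp add: c_def)
    finally show ?thesis
      unfolding bool cls using upper lower by linarith
  qed (use k in \<open>auto simp: Xmap_inv_def power_0_left\<close>)
qed

text \<open>The uniform bound makes the Boolean powers and the \<open>\<X>\<^sup>-\<^sup>1\<close>-images of the classical powers
  converge to the same limits, and \<open>\<X>\<^sup>-\<^sup>1\<close> can be removed because it is a homeomorphism.\<close>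

lemma tendsto_power_iff_tendsto_boolean_power:
  fixes u :: "nat \<Rightarrow> real"
  assumes u: "\<And>n. u n \<in> {0..1}" and a: "a \<in> {0..1}"
    and k: "\<And>n. k n > 0" "strict_mono k"
  shows "(\<lambda>n. u n ^ k n) \<longlonglongrightarrow> a \<longleftrightarrow>
         (\<lambda>n. u n / (real (k n) - (real (k n) - 1) * u n)) \<longlonglongrightarrow> Xmap_inv a"
    (is "_ \<longleftrightarrow> ?b \<longlonglongrightarrow> _")
proof -
  let ?c = "\<lambda>n. Xmap_inv (u n ^ k n)"
  have "(\<lambda>n. 1 / real (k n)) \<longlonglongrightarrow> 0"
    by (rule LIMSEQ_subseq_LIMSEQ[OF lim_1_over_n k(2), unfolded o_def])
  then have "(\<lambda>n. ?c n - ?b n) \<longlonglongrightarrow> 0"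
    by (rule Lim_null_comparison[rotated]) (use Xmap_inv_power_approx[OF u k(1)] in simp)
  then have "?b \<longlonglongrightarrow> Xmap_inv a \<longleftrightarrow> ?c \<longlonglongrightarrow> Xmap_inv a"
    by (rule Lim_transform_eq[symmetric])
  also have "\<dots> \<longleftrightarrow> (\<lambda>n. u n ^ k n) \<longlonglongrightarrow> a"
    using u a by (intro tendsto_Xmap_inv_iff) (auto intro: power_le_one)
  finally show ?thesis by simp
qed

section \<open>Distribution functions on the half-line and their weak limits\<close>

lemma Delta_plus_compose:
  assumes F: "F \<in> Delta_plus"
    and cont: "continuous_on {0..1} \<phi>" and mono: "mono_on {0..1} \<phi>"
    and ends: "\<phi> 0 = 0" "\<phi> 1 = 1"
  shows "(\<lambda>x. \<phi> (F x)) \<in> Delta_plus"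
proof -
  obtain M where M: "real_distribution M" "F = cdf M" and neg: "\<And>x. x < 0 \<Longrightarrow> F x = 0"
    using F by (auto simp: Delta_plus_def)
  interpret real_distribution M by fact
  have bounds: "F x \<in> {0..1}" for x
    using Delta_plus_bounds[OF F] by simp
  have lim: "((\<lambda>x. \<phi> (F x)) \<longlongrightarrow> \<phi> l) N" if "(F \<longlongrightarrow> l) N" "l \<in> {0..1}" for l N
    using continuous_on_tendsto_compose[OF cont that] bounds by simp
  let ?G = "\<lambda>x. \<phi> (F x)"
  have mono_G: "?G x \<le> ?G y" if "x \<le> y" for x y
    using mono_onD[OF mono bounds bounds] cdf_nondecreasing[OF that] M(2) by simp
  have rc_G: "continuous (at_right x) ?G" for x
    using lim[of "F x"] cdf_is_right_cont[of x] bounds M(2) by (simp add: continuous_within)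
  have bot_G: "(?G \<longlongrightarrow> 0) at_bot"
    using lim[of 0] cdf_lim_at_bot M(2) ends by simp
  have top_G: "(?G \<longlongrightarrow> 1) at_top"
    using lim[of 1] cdf_lim_at_top_prob M(2) ends by simp
  have "real_distribution (interval_measure ?G)"
    by (rule real_distribution_interval_measure[OF mono_G rc_G bot_G top_G])
  moreover have "cdf (interval_measure ?G) = ?G"
    by (rule cdf_interval_measure[OF mono_G rc_G bot_G])
  ultimately have "\<exists>M. real_distribution M \<and> ?G = cdf M"
    by metis
  then show ?thesis
    using neg ends by (auto simp: Delta_plus_def)
qed

lemma Delta_plus_Xmap: "F \<in> Delta_plus \<Longrightarrow> (\<lambda>x. Xmap (F x)) \<in> Delta_plus"
  by (rule Delta_plus_compose[OF _ continuous_on_Xmap mono_on_Xmap]) (simp_all add: Xmap_def)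

lemma Delta_plus_Xmap_inv: "F \<in> Delta_plus \<Longrightarrow> (\<lambda>x. Xmap_inv (F x)) \<in> Delta_plus"
  by (rule Delta_plus_compose[OF _ continuous_on_Xmap_inv mono_on_Xmap_inv])
     (simp_all add: Xmap_inv_def)

text \<open>Two weak limits agree wherever both are continuous, that is, off a countable set. If they
  differed at \<open>x\<close>, then by right continuity they would differ on an interval to the right of \<open>x\<close>,
  which is uncountable.\<close>

lemma weak_conv_cdf_unique:
  assumes "finite_borel_measure M" "finite_borel_measure N"
    and convM: "weak_conv A (cdf M)" and convN: "weak_conv A (cdf N)"
  shows "cdf M = cdf N"
proof
  interpret M: finite_borel_measure M by fact
  interpret N: finite_borel_measure N by fact
  define D where "D = {x. measure M {x} > 0} \<union> {x. measure N {x} > 0}"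
  have "countable D"
    unfolding D_def using M.countable_atoms N.countable_atoms by simp
  have agree: "cdf M y = cdf N y" if "y \<notin> D" for y
  proof -
    have "isCont (cdf M) y" "isCont (cdf N) y"
      using that by (auto simp: D_def M.isCont_cdf N.isCont_cdf zero_less_measure_iff)
    then have "(\<lambda>n. A n y) \<longlonglongrightarrow> cdf M y" "(\<lambda>n. A n y) \<longlonglongrightarrow> cdf N y"
      using convM convN by (auto simp: weak_conv_def)
    then show ?thesis by (rule LIMSEQ_unique)
  qed
  fix x
  show "cdf M x = cdf N x"
  proof (rule ccontr)
    assume "cdf M x \<noteq> cdf N x"
    moreover have "((\<lambda>y. cdf M y - cdf N y) \<longlongrightarrow> cdf M x - cdf N x) (at_right x)"
      using M.cdf_is_right_cont[of x] N.cdf_is_right_cont[of x]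
      by (intro tendsto_diff) (simp_all add: continuous_within)
    ultimately have "\<forall>\<^sub>F y in at_right x. cdf M y - cdf N y \<noteq> 0"
      by (intro tendsto_imp_eventually_ne) auto
    then obtain b where "x < b" "\<And>y. x < y \<Longrightarrow> y < b \<Longrightarrow> cdf M y \<noteq> cdf N y"
      by (auto simp: eventually_at_right_field)
    then have "{x<..<b} \<subseteq> D"
      using agree by fastforce
    then show False
      using \<open>countable D\<close> \<open>x < b\<close> uncountable_open_interval[of x b] countable_subset by blast
  qed
qed

text \<open>The continuity points of \<open>F\<close> and \<open>\<X>\<^sup>-\<^sup>1(F)\<close> coincide, so the pointwise equivalence applies
  at each of them.\<close>

lemma weak_conv_max_iff_boolean:
  assumes Fs: "\<And>n. Fs n \<in> Delta_plus" and k: "\<And>n. k n > 0" "strict_mono k"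
    and F: "F \<in> Delta_plus"
  shows "weak_conv (\<lambda>n. max_conv_power (k n) (Fs n)) F \<longleftrightarrow>
         weak_conv (\<lambda>n. bool_max_conv_power (k n) (Fs n)) (\<lambda>x. Xmap_inv (F x))"
proof -
  have bounds: "F x \<in> {0..1}" "Fs n x \<in> {0..1}" for n x
    using Delta_plus_bounds[OF F] Delta_plus_bounds[OF Fs] by auto
  have cont: "isCont (\<lambda>x. Xmap_inv (F x)) x \<longleftrightarrow> isCont F x" for x
    unfolding continuous_at using bounds by (intro tendsto_Xmap_inv_iff)
  show ?thesis
    unfolding weak_conv_def cont max_conv_power_eq[OF k(1)] bool_max_conv_power_eq[OF k(1) Fs]
    using tendsto_power_iff_tendsto_boolean_power[OF bounds(2) bounds(1) k] by simp
qed

theorem theorem6p1: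
  fixes Fs :: "nat \<Rightarrow> real \<Rightarrow> real" and k :: "nat \<Rightarrow> nat"
  assumes "\<And>n. Fs n \<in> Delta_plus"
    and "\<And>n. k n > 0"
    and "strict_mono k"
  shows "((\<exists>F\<in>Delta_plus. weak_conv (\<lambda>n. max_conv_power (k n) (Fs n)) F) \<longleftrightarrow>
          (\<exists>G\<in>Delta_plus. weak_conv (\<lambda>n. bool_max_conv_power (k n) (Fs n)) G)) \<and>
         (\<forall>F\<in>Delta_plus. \<forall>G\<in>Delta_plus.
            weak_conv (\<lambda>n. max_conv_power (k n) (Fs n)) F \<longrightarrow>
            weak_conv (\<lambda>n. bool_max_conv_power (k n) (Fs n)) G \<longrightarrow>
            (\<lambda>x. Xmap (G x)) = F \<and> (\<lambda>x. Xmap_inv (F x)) = G)"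
    (is "((\<exists>F\<in>_. ?max F) \<longleftrightarrow> (\<exists>G\<in>_. ?bool G)) \<and> _")
proof -
  have iff: "?max F \<longleftrightarrow> ?bool (\<lambda>x. Xmap_inv (F x))" if "F \<in> Delta_plus" for F
    using weak_conv_max_iff_boolean[of Fs k F] assms that by blast
  have inv: "Xmap_inv (Xmap (F x)) = F x" "Xmap (Xmap_inv (F x)) = F x"
    if "F \<in> Delta_plus" for F x
    using Delta_plus_bounds[OF that, of x] Xmap_inverse(3,4)[of "F x"] by auto
  have "\<exists>G\<in>Delta_plus. ?bool G" if "F \<in> Delta_plus" "?max F" for F
    using iff Delta_plus_Xmap_inv that by blast
  moreover have "\<exists>F\<in>Delta_plus. ?max F" if "G \<in> Delta_plus" "?bool G" for G
    using iff[OF Delta_plus_Xmap[OF that(1)]] Delta_plus_Xmap[OF that(1)] inv(1)[OF that(1)] that(2)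
    by auto
  moreover have "(\<lambda>x. Xmap (G x)) = F \<and> (\<lambda>x. Xmap_inv (F x)) = G"
    if F: "F \<in> Delta_plus" "?max F" and G: "G \<in> Delta_plus" "?bool G" for F G
  proof -
    obtain M N where "real_distribution M" "(\<lambda>x. Xmap_inv (F x)) = cdf M"
      and "real_distribution N" "G = cdf N"
      using Delta_plus_Xmap_inv[OF F(1)] G(1) by (auto simp: Delta_plus_def)
    moreover have "?bool (\<lambda>x. Xmap_inv (F x))"
      using iff F by blast
    ultimately have "(\<lambda>x. Xmap_inv (F x)) = G"
      using weak_conv_cdf_unique[of M N] G(2) real_distribution.finite_borel_measure_M by metis
    then show ?thesis
      using inv(2)[OF F(1)] by auto
  qed
  ultimately show ?thesis by blast
qed

end
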